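(* Let $N\ge 2$ be an integer, let $\{(t_n,x_n): n=0,1,\dots,N\}\subset\mathbb{R}^2$ be a data set with $t_0<t_1<\dots<t_N$, and let $g_0:[t_0,t_N]\to\mathbb{R}$ be the piecewise linear function through the points $(t_n,x_n)$, $n=0,1,\dots,N$. Then $g_0$ can be calculated by solving a system of two linear equations on each subinterval: for every $n=1,\dots,N$ and every $t\in[t_{n-1},t_n]$, $$g_0(t)=a_n t+b_n,$$ where $(a_n,b_n)\in\mathbb{R}^2$ is the solution of the system $$a_n t_n+b_n=x_n,\qquad a_n t_{n-1}+b_n=x_{n-1}.$$
   Context: The piecewise linear function through the points $(t_n,x_n)$ is the continuous function on $[t_0,t_N]$ that is affine on each subinterval $[t_{n-1},t_n]$ and takes the value $x_n$ at $t_n$ for $n=0,\dots,N$. *)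

theory Defs
  imports "HOL-Analysis.Analysis"
begin

definition affine_function_on :: "real set \<Rightarrow> (real \<Rightarrow> real) \<Rightarrow> bool" where
  "affine_function_on S g \<longleftrightarrow> (\<exists>c d. \<forall>s\<in>S. g s = c * s + d)"

(* The function lives on the interval from t 0 to t N; it is represented by a total
   function whose values outside this interval are unconstrained. Only t n and x n with
   n \<le> N are relevant. *)
definition piecewise_linear_through ::
    "nat \<Rightarrow> (nat \<Rightarrow> real) \<Rightarrow> (nat \<Rightarrow> real) \<Rightarrow> (real \<Rightarrow> real) \<Rightarrow> bool" where
  "piecewise_linear_through N t x g \<longleftrightarrow>
     continuous_on {t 0..t N} g \<and>
     (\<forall>n\<in>{1..N}. affine_function_on {t (n - 1)..t n} g) \<and>
     (\<forall>n\<in>{0..N}. g (t n) = x n)"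

end

theory Submission imports Defs begin

text \<open>On a single subinterval \<open>g\<^sub>0\<close> is affine by definition, say with
  coefficients \<open>c\<close> and \<open>d\<close>. Evaluating at the two endpoints, where the
  values are prescribed, shows that \<open>(c, d)\<close> solves the system, so existence comes from
  \<open>g\<^sub>0\<close> itself and no explicit solution formula is needed. Since the two nodes
  are distinct, an affine function is determined by its values there
  (\<open>affine_coefficients_unique\<close>); hence every solution is \<open>(c, d)\<close> and
  represents \<open>g\<^sub>0\<close> on the subinterval.\<close>

lemma affine_coefficients_unique:
  fixes a b c d u v :: real
  assumes "u \<noteq> v" and "a * u + b = c * u + d" and "a * v + b = c * v + d"
  shows "a = c \<and> b = d"
proof -
  \<comment> \<open>Subtracting the two equations eliminates \<open>b\<close> and
    \<open>d\<close>.\<close>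
  have "(a - c) * (u - v) = 0"
    using assms(2,3) by (simp add: left_diff_distrib right_diff_distrib)
  then have "a = c" using assms(1) by simp
  then show ?thesis using assms(2) by simp
qed

theorem theorem5p2:
  fixes N :: nat and t x :: "nat \<Rightarrow> real" and g\<^sub>0 :: "real \<Rightarrow> real"
  assumes "N \<ge> 2"
    and "strict_mono_on {0..N} t"
    and "piecewise_linear_through N t x g\<^sub>0"
  shows "\<forall>n\<in>{1..N}.
           (\<exists>!(a, b). a * t n + b = x n \<and> a * t (n - 1) + b = x (n - 1)) \<and>
           (\<forall>a b. a * t n + b = x n \<and> a * t (n - 1) + b = x (n - 1) \<longrightarrow>
              (\<forall>s\<in>{t (n - 1)..t n}. g\<^sub>0 s = a * s + b))"
proof
  fix n assume n: "n \<in> {1..N}"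
  \<comment> \<open>As \<open>n\<close> is at least 1, the natural-number subtraction
    \<open>n - 1\<close> does not truncate and gives the true predecessor.\<close>
  have less: "t (n - 1) < t n"
    using n by (intro strict_mono_onD[OF assms(2)]) auto
  then have neq: "t (n - 1) \<noteq> t n" by simp
  have "n \<in> {0..N}" "n - 1 \<in> {0..N}" using n by auto
  then have val: "g\<^sub>0 (t n) = x n" "g\<^sub>0 (t (n - 1)) = x (n - 1)"
    using assms(3) unfolding piecewise_linear_through_def by blast+
  obtain c d where cd: "\<And>s. s \<in> {t (n - 1)..t n} \<Longrightarrow> g\<^sub>0 s = c * s + d"
    using assms(3) n unfolding piecewise_linear_through_def affine_function_on_def by blast
  \<comment> \<open>By \<open>less\<close>, both nodes belong to the closed subinterval, so
    \<open>cd\<close> applies to them.\<close>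
  have sol: "c * t n + d = x n \<and> c * t (n - 1) + d = x (n - 1)"
    using val less cd[of "t n"] cd[of "t (n - 1)"] by simp
  have uniq: "a = c \<and> b = d" if "a * t n + b = x n \<and> a * t (n - 1) + b = x (n - 1)" for a b
    using that sol by (intro affine_coefficients_unique[OF neq]) simp_all
  show "(\<exists>!(a, b). a * t n + b = x n \<and> a * t (n - 1) + b = x (n - 1)) \<and>
        (\<forall>a b. a * t n + b = x n \<and> a * t (n - 1) + b = x (n - 1) \<longrightarrow>
           (\<forall>s\<in>{t (n - 1)..t n}. g\<^sub>0 s = a * s + b))"
  proof
    show "\<exists>!(a, b). a * t n + b = x n \<and> a * t (n - 1) + b = x (n - 1)"
    proof (rule ex1I[of _ "(c, d)"])
      show "case (c, d) of (a, b) \<Rightarrow> a * t n + b = x n \<and> a * t (n - 1) + b = x (n - 1)"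
        unfolding prod.case by (rule sol)
    next
      fix p :: "real \<times> real"
      assume "case p of (a, b) \<Rightarrow> a * t n + b = x n \<and> a * t (n - 1) + b = x (n - 1)"
      \<comment> \<open>Writing the pair pattern with \<open>fst\<close> and \<open>snd\<close>
        gives exactly the premise of \<open>uniq\<close>.\<close>
      then have "fst p = c \<and> snd p = d"
        unfolding case_prod_beta by (rule uniq)
      then show "p = (c, d)" by (simp add: prod_eq_iff)
    qed
    show "\<forall>a b. a * t n + b = x n \<and> a * t (n - 1) + b = x (n - 1) \<longrightarrow>
            (\<forall>s\<in>{t (n - 1)..t n}. g\<^sub>0 s = a * s + b)"
    proof (intro allI impI ballI)
      fix a b s
      assume "a * t n + b = x n \<and> a * t (n - 1) + b = x (n - 1)" and s: "s \<in> {t (n - 1)..t n}"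
      then have "a = c" "b = d" using uniq[of a b] by simp_all
      then show "g\<^sub>0 s = a * s + b" using cd[OF s] by simp
    qed
  qed
qed

end
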